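(* Let $\lambda_0 = 0.400436\ldots$ be the unique positive solution of the equation $$9\lambda^4 - 3\lambda^3 + \lambda^2 + 2\lambda - 1 = 0,$$ and let $\lambda$ be a real number with $\lambda_0 \le \lambda \le 1$. Let $f(z) = z + a_2 z^2 + a_3 z^3 + \cdots$ belong to the class $\mathcal{U}(\lambda)$. If, additionally, $f$ satisfies the subordination $$\frac{f(z)}{z} \prec \frac{1}{(1+z)(1+\lambda z)},$$ then $$|a_5| \le 1 + \lambda + \lambda^2 + \lambda^3 + \lambda^4.$$ The result is sharp, i.e., for every $\lambda$ with $\lambda_0 \le \lambda \le 1$ there exists a function $f \in \mathcal{U}(\lambda)$ satisfying this subordination for which equality holds.
   Context: Let $\mathbb{D} = \{z \in \mathbb{C} : |z| < 1\}$ be the open unit disk. Let $\mathcal{A}$ denote the class of functions $f$ analytic in $\mathbb{D}$ and normalized by $f(0) = f'(0) - 1 = 0$, i.e., with expansion $f(z) = z + a_2 z^2 + a_3 z^3 + \cdots$ in $\mathbb{D}$. For $0 < \lambda \le 1$, the class $\mathcal{U}(\lambda)$ is $$\mathcal{U}(\lambda) = \left\{ f \in \mathcal{A} : \left| \left( \frac{z}{f(z)} \right)^2 f'(z) - 1 \right| < \lambda \text{ for all } z \in \mathbb{D} \right\},$$ where $z/f(z)$ and $f(z)/z$ are understood to take the value $1$ at $z = 0$. Subordination: for $F$ and $G$ analytic in $\mathbb{D}$, $F(z) \prec G(z)$ means that there exists a function $\omega$ analytic in $\mathbb{D}$ with $\omega(0) = 0$ and $|\omega(z)| < 1$ for all $z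 \in \mathbb{D}$ such that $F(z) = G(\omega(z))$ for all $z \in \mathbb{D}$. *)

theory Defs
  imports "HOL-Complex_Analysis.Complex_Analysis"
begin

abbreviation unit_disk :: "complex set" where
  "unit_disk \<equiv> ball 0 1"

definition class_A :: "(complex \<Rightarrow> complex) set" where
  "class_A = {f. f holomorphic_on unit_disk \<and> f 0 = 0 \<and> deriv f 0 = 1}"

definition id_over :: "(complex \<Rightarrow> complex) \<Rightarrow> complex \<Rightarrow> complex" where
  "id_over f z = (if z = 0 then 1 else z / f z)"

definition over_id :: "(complex \<Rightarrow> complex) \<Rightarrow> complex \<Rightarrow> complex" where
  "over_id f z = (if z = 0 then 1 else f z / z)"

(* Intended for 0 < lam <= 1.  Since x / 0 = 0, a zero of f other than the origin would
   make the norm below equal to 1, so the strict inequality excludes such zeros and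
   z / f z is a genuine quotient for every member of the class. *)
definition class_U :: "real \<Rightarrow> (complex \<Rightarrow> complex) set" where
  "class_U lam =
     {f \<in> class_A. \<forall>z\<in>unit_disk. norm ((id_over f z)\<^sup>2 * deriv f z - 1) < lam}"

definition subordinate :: "(complex \<Rightarrow> complex) \<Rightarrow> (complex \<Rightarrow> complex) \<Rightarrow> bool"
    (infix \<open>\<prec>\<^sub>s\<close> 50) where
  "F \<prec>\<^sub>s G \<longleftrightarrow>
     F holomorphic_on unit_disk \<and> G holomorphic_on unit_disk \<and>
     (\<exists>w. w holomorphic_on unit_disk \<and> w 0 = 0 \<and> (\<forall>z\<in>unit_disk. norm (w z) < 1) \<and>
          (\<forall>z\<in>unit_disk. F z = G (w z)))"

definition taylor_coeff :: "(complex \<Rightarrow> complex) \<Rightarrow> nat \<Rightarrow> complex" where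
  "taylor_coeff f n = fps_nth (fps_expansion f 0) n"

definition is_pos_root :: "real \<Rightarrow> bool" where
  "is_pos_root x \<longleftrightarrow> 0 < x \<and> 9 * x ^ 4 - 3 * x ^ 3 + x ^ 2 + 2 * x - 1 = 0"

definition lambda0 :: real where
  "lambda0 = (THE x. is_pos_root x)"

end

theory Submission
  imports Defs
begin

text \<open>Write \<open>F(z) = f(z)/z\<close> and \<open>v = - w\<close>, where \<open>w\<close> is the function from the subordination, so that
\<open>F = 1 / ((1 - v) (1 - \<lambda>v))\<close> and \<open>a\<^sub>5\<close> is the coefficient of \<open>z^4\<close> in \<open>F\<close>. The proof rests on
the identity
\[ F = (1 + \lambda)\, \frac{1}{1 - v} - \lambda + \lambda^2 v^2 F . \]
The function \<open>1/(1 - v)\<close> takes its values in the half-plane \<open>Re > 1/2\<close> and equals 1 at the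
origin, so by Caratheodory none of its coefficients exceeds 1 in modulus
(\<open>half_plane_coeff_le_1\<close>). Hence the bound
\<open>1 + \<lambda> + \<lambda>\<^sup>2 + \<lambda>\<^sup>3 + \<lambda>\<^sup>4 = (1 + \<lambda>) + \<lambda>\<^sup>2 (1 + \<lambda> + \<lambda>\<^sup>2)\<close> follows once the coefficient of \<open>z^4\<close>
in \<open>v\<^sup>2 F\<close> is at most \<open>1 + \<lambda> + \<lambda>\<^sup>2\<close> in modulus. With \<open>v = z (c\<^sub>0 + c\<^sub>1 z + c\<^sub>2 z\<^sup>2 + \<dots>)\<close>
that coefficient is
\[ (1 + \lambda + \lambda^2) c_0^4 + 3 (1 + \lambda) c_0^2 c_1 + 2 c_0 c_2 + c_1^2 . \]

By the Schwarz lemma \<open>v(z)/z\<close> is bounded by 1, and the first three coefficients of such a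
function are described by Schur's algorithm. In these parameters the functional
\<open>(1 + D) c\<^sub>0^4 + B c\<^sub>0\<^sup>2 c\<^sub>1 + 2 c\<^sub>0 c\<^sub>2 + c\<^sub>1\<^sup>2\<close> becomes a function of one real and one complex
variable, and it is bounded by \<open>1 + D\<close> as soon as \<open>B\<^sup>2 \<le> 32 D\<close> (\<open>schur_functional_le\<close>).
For \<open>D = \<lambda> + \<lambda>\<^sup>2\<close> and \<open>B = 3 (1 + \<lambda>)\<close> this condition reads \<open>\<lambda> \<ge> 9/23\<close>, and \<open>9/23 < \<lambda>\<^sub>0\<close>.

Equality holds for \<open>f(z) = z / ((1 + z) (1 + \<lambda>z))\<close>, where \<open>w(z) = z\<close>.\<close>

section \<open>Power series on the unit disk\<close>

lemma unit_disk_has_fps_expansion: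
  "f holomorphic_on ball 0 1 \<Longrightarrow> f has_fps_expansion fps_expansion f 0"
  by (rule has_fps_expansion_fps_expansion[of "ball 0 1"]) auto

lemma fps_expansion_nth_0 [simp]: "fps_nth (fps_expansion f 0) 0 = f 0"
  by (simp add: fps_expansion_def)

text \<open>Functional equations that hold on the disk are turned into identities of formal power series by
this rule, so that coefficients can be compared.\<close>

lemma has_fps_expansion_eq_on_disk:
  fixes f g :: "complex \<Rightarrow> complex"
  assumes "f has_fps_expansion F" "g has_fps_expansion G"
    and "\<And>z. norm z < 1 \<Longrightarrow> f z = g z"
  shows "F = G"
proof -
  have "eventually (\<lambda>z. z \<in> ball (0::complex) 1) (nhds 0)"
    by (intro eventually_nhds_in_open) auto
  then have "eventually (\<lambda>z. f z = g z) (nhds 0)"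
    by eventually_elim (use assms(3) in simp)
  then have "g has_fps_expansion F"
    using assms(1) has_fps_expansion_cong by blast
  then show ?thesis
    using assms(2) fps_expansion_unique_complex by blast
qed

section \<open>Schur functions and their first coefficients\<close>

text \<open>The bound is not strict, so that unimodular constants are included and the class is closed under
Schur's algorithm.\<close>

definition schur_function :: "(complex \<Rightarrow> complex) \<Rightarrow> bool" where
  "schur_function f \<longleftrightarrow> f holomorphic_on ball 0 1 \<and> (\<forall>z. norm z < 1 \<longrightarrow> norm (f z) \<le> 1)"

text \<open>One step of Schur's algorithm: move \<open>f(0)\<close> to the origin by a disk automorphism and divide by \<open>z\<close>,
which keeps the bound by the Schwarz lemma. Multiplying out the automorphism covers the degenerate
case as well: if \<open>|f|\<close> attains 1, then \<open>f\<close> is constant and \<open>g = 0\<close> will do.\<close>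

lemma schur_step:
  assumes "schur_function f"
  shows "\<exists>g. schur_function g \<and>
    (\<forall>z. norm z < 1 \<longrightarrow> f z - f 0 = z * g z * (1 - cnj (f 0) * f z))"
proof (cases "\<exists>w. norm w < 1 \<and> norm (f w) = 1")
  case True
  have holo: "f holomorphic_on ball 0 1" and bound: "\<And>z. norm z < 1 \<Longrightarrow> norm (f z) \<le> 1"
    using assms by (auto simp: schur_function_def)
  from True obtain w where w: "norm w < 1" "norm (f w) = 1" by blast
  have "f constant_on ball 0 1"
  proof (rule Schwarz2[OF holo, of "1 - norm w" w])
    show ball: "ball w (1 - norm w) \<subseteq> ball 0 1"
      by (simp add: ball_subset_ball_iff)
    show "norm (f z) \<le> norm (f w)" if "norm (w - z) < 1 - norm w" for z
    proof -
      have "z \<in> ball w (1 - norm w)"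
        using that by (simp add: dist_norm)
      then show ?thesis
        using ball bound w(2) by auto
    qed
  qed (use w in simp)
  then have "f z - f 0 = 0" if "norm z < 1" for z
    using that by (force simp: constant_on_def)
  then show ?thesis
    by (intro exI[of _ "\<lambda>_. 0"] conjI allI impI)
      (simp_all only: schur_function_def holomorphic_on_const norm_zero mult_zero_left mult_zero_right zero_le_one simp_thms)
next
  case False
  have holo: "f holomorphic_on ball 0 1" and bound: "\<And>z. norm z < 1 \<Longrightarrow> norm (f z) \<le> 1"
    using assms by (auto simp: schur_function_def)
  have less: "norm (f z) < 1" if "norm z < 1" for z
    using bound[OF that] False that by force
  define m where "m z = Moebius_function 0 (f 0) (f z)" for z
  have m0: "m 0 = 0"
    by (simp add: m_def Moebius_function_eq_zero)
  have m_holo: "m holomorphic_on ball 0 1"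
  proof -
    have "Moebius_function 0 (f 0) \<circ> f holomorphic_on ball 0 1"
      by (rule holomorphic_on_compose_gen[OF holo Moebius_function_holomorphic])
        (auto simp: less)
    then show ?thesis
      by (simp add: m_def[abs_def] o_def)
  qed
  have m_less: "norm (m z) < 1" if "norm z < 1" for z
    unfolding m_def by (intro Moebius_function_norm_lt_1 less that) simp
  obtain h where h: "h holomorphic_on ball 0 1" "\<And>z. norm z < 1 \<Longrightarrow> m z = z * h z" "deriv m 0 = h 0"
    by (rule Schwarz3[OF m_holo m0]) auto
  have h_le: "norm (h z) \<le> 1" if z: "norm z < 1" for z
  proof (cases "z = 0")
    case True
    have "norm (deriv m 0) \<le> 1"
      by (rule Schwarz_Lemma(2)[OF m_holo m0 _ z]) (use m_less in auto)
    then show ?thesis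
      using h(3) True by simp
  next
    case False
    have "norm (m z) \<le> norm z"
      by (rule Schwarz_Lemma(1)[OF m_holo m0 _ z]) (use m_less in auto)
    then show ?thesis
      using h(2)[OF z] False by (simp add: norm_mult)
  qed
  have "f z - f 0 = z * h z * (1 - cnj (f 0) * f z)" if z: "norm z < 1" for z
  proof -
    have "norm (cnj (f 0) * f z) < 1 * 1"
      unfolding norm_mult using less[of 0] less[OF z]
      by (intro mult_strict_mono') auto
    then have "1 - cnj (f 0) * f z \<noteq> 0"
      by auto
    then show ?thesis
      using h(2)[OF z] by (simp add: m_def Moebius_function_simple field_simps)
  qed
  then show ?thesis
    using h(1) h_le by (auto simp: schur_function_def)
qed

lemma schur_step_fps:
  assumes "schur_function f"
  shows "\<exists>g. schur_function g \<and> fps_expansion f 0 - fps_const (f 0)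
      = fps_X * fps_expansion g 0 * (1 - fps_const (cnj (f 0)) * fps_expansion f 0)"
proof -
  obtain g where g: "schur_function g"
      "\<forall>z. norm z < 1 \<longrightarrow> f z - f 0 = z * g z * (1 - cnj (f 0) * f z)"
    using schur_step[OF assms] by blast
  have exp: "f has_fps_expansion fps_expansion f 0" "g has_fps_expansion fps_expansion g 0"
    using assms g(1) by (auto simp: schur_function_def intro: unit_disk_has_fps_expansion)
  have "fps_expansion f 0 - fps_const (f 0)
      = fps_X * fps_expansion g 0 * (1 - fps_const (cnj (f 0)) * fps_expansion f 0)"
  proof (rule has_fps_expansion_eq_on_disk)
    show "(\<lambda>z. f z - f 0) has_fps_expansion fps_expansion f 0 - fps_const (f 0)"
      by (intro fps_expansion_intros exp)
    show "(\<lambda>z. z * g z * (1 - cnj (f 0) * f z)) has_fps_expansion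
        fps_X * fps_expansion g 0 * (1 - fps_const (cnj (f 0)) * fps_expansion f 0)"
      by (intro fps_expansion_intros exp)
  qed (use g(2) in blast)
  with g(1) show ?thesis by blast
qed

lemma schur_step_coeffs:
  fixes F G :: "complex fps"
  assumes "F - fps_const (fps_nth F 0) = fps_X * G * (1 - fps_const (cnj (fps_nth F 0)) * F)"
  shows "fps_nth F 1 = of_real (1 - (norm (fps_nth F 0))\<^sup>2) * fps_nth G 0"
    and "fps_nth F 2 = of_real (1 - (norm (fps_nth F 0))\<^sup>2) *
      (fps_nth G 1 - cnj (fps_nth F 0) * (fps_nth G 0)\<^sup>2)"
proof -
  define c where "c = fps_nth F 0"
  define K where "K = 1 - fps_const (cnj c) * F"
  have eq: "F = fps_const c + fps_X * (G * K)"
    using assms unfolding c_def[symmetric] K_def mult.assoc by (metis diff_add_cancel add.commute)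
  have "cnj c * c = of_real ((norm c)\<^sup>2)"
    by (subst complex_norm_square) (rule mult.commute)
  then have K0: "fps_nth K 0 = of_real (1 - (norm c)\<^sup>2)"
    by (simp add: K_def c_def)
  have K1: "fps_nth K 1 = - cnj c * fps_nth F 1"
    by (simp add: K_def)
  have "fps_nth F 1 = fps_nth (fps_const c + fps_X * (G * K)) 1"
    using eq by (rule arg_cong)
  then have F1: "fps_nth F 1 = of_real (1 - (norm c)\<^sup>2) * fps_nth G 0"
    by (simp add: K0)
  have "fps_nth F 2 = fps_nth (fps_const c + fps_X * (G * K)) 2"
    using eq by (rule arg_cong)
  then have "fps_nth F 2 = fps_nth G 0 * fps_nth K 1 + fps_nth G 1 * fps_nth K 0"
    by (simp add: fps_mult_nth[of G] numeral_2_eq_2)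
  then have "fps_nth F 2 = of_real (1 - (norm c)\<^sup>2) * (fps_nth G 1 - cnj c * (fps_nth G 0)\<^sup>2)"
    unfolding K0 K1 F1 by (simp add: power2_eq_square algebra_simps)
  with F1 show "fps_nth F 1 = of_real (1 - (norm (fps_nth F 0))\<^sup>2) * fps_nth G 0"
    "fps_nth F 2 = of_real (1 - (norm (fps_nth F 0))\<^sup>2) *
      (fps_nth G 1 - cnj (fps_nth F 0) * (fps_nth G 0)\<^sup>2)"
    unfolding c_def by blast+
qed

text \<open>Two steps of the algorithm describe the first three coefficients: \<open>y\<close> is the constant term after
the first step, and the linear term after that step is \<open>(1 - |y|\<^sup>2) s\<close>.\<close>

lemma schur_parameters:
  assumes "schur_function f"
  defines "c \<equiv> fps_nth (fps_expansion f 0)"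
  obtains y s where "norm y \<le> 1" "norm s \<le> 1"
    "c 1 = of_real (1 - (norm (c 0))\<^sup>2) * y"
    "c 2 = of_real (1 - (norm (c 0))\<^sup>2) * (of_real (1 - (norm y)\<^sup>2) * s - cnj (c 0) * y\<^sup>2)"
proof -
  obtain g where g: "schur_function g"
    "fps_expansion f 0 - fps_const (f 0)
      = fps_X * fps_expansion g 0 * (1 - fps_const (cnj (f 0)) * fps_expansion f 0)"
    using schur_step_fps[OF assms(1)] by blast
  obtain h where h: "schur_function h"
    "fps_expansion g 0 - fps_const (g 0)
      = fps_X * fps_expansion h 0 * (1 - fps_const (cnj (g 0)) * fps_expansion g 0)"
    using schur_step_fps[OF g(1)] by blast
  note f_coeffs = schur_step_coeffs[of "fps_expansion f 0" "fps_expansion g 0", unfolded fps_expansion_nth_0, OF g(2)]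
  note g_coeffs = schur_step_coeffs[of "fps_expansion g 0" "fps_expansion h 0", unfolded fps_expansion_nth_0, OF h(2)]
  have "norm (g 0) \<le> 1" "norm (h 0) \<le> 1"
    using g(1) h(1) by (simp_all add: schur_function_def)
  moreover have "c 1 = of_real (1 - (norm (c 0))\<^sup>2) * g 0"
    unfolding c_def fps_expansion_nth_0 by (rule f_coeffs(1))
  moreover have "c 2 = of_real (1 - (norm (c 0))\<^sup>2) *
        (of_real (1 - (norm (g 0))\<^sup>2) * h 0 - cnj (c 0) * (g 0)\<^sup>2)"
    unfolding c_def fps_expansion_nth_0 by (rule f_coeffs(2)[unfolded g_coeffs(1)])
  ultimately show ?thesis
    by (rule that)
qed

text \<open>Cauchy's inequality on circles of radius \<open>r < 1\<close>, in the limit \<open>r \<longrightarrow> 1\<close>.\<close>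

lemma schur_coeff_le_1:
  assumes "schur_function f"
  shows "norm (fps_nth (fps_expansion f 0) n) \<le> 1"
proof -
  have holo: "f holomorphic_on ball 0 1" and bound: "\<And>z. norm z < 1 \<Longrightarrow> norm (f z) \<le> 1"
    using assms by (auto simp: schur_function_def)
  define c where "c = norm (fps_nth (fps_expansion f 0) n)"
  have "c * r ^ n \<le> 1" if r: "0 < r" "r < 1" for r :: real
  proof -
    have "norm ((deriv ^^ n) f 0) \<le> fact n * 1 / r ^ n"
    proof (rule Cauchy_inequality)
      show "f holomorphic_on ball 0 r"
        by (rule holomorphic_on_subset[OF holo]) (use r in auto)
      show "continuous_on (cball 0 r) f"
        by (rule continuous_on_subset[OF holomorphic_on_imp_continuous_on[OF holo]]) (use r in auto)
    qed (use r bound in auto)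
    then show ?thesis
      using r by (simp add: c_def fps_expansion_def norm_divide field_simps)
  qed
  then have "eventually (\<lambda>r. c * r ^ n \<le> 1) (at_left 1)"
    by (intro eventually_at_leftI[of 0]) auto
  moreover have "((\<lambda>r::real. c * r ^ n) \<longlongrightarrow> c * 1 ^ n) (at_left 1)"
    by (intro tendsto_intros)
  ultimately show ?thesis
    using tendsto_upperbound[of "\<lambda>r. c * r ^ n" "c * 1 ^ n" "at_left 1" 1] by (simp add: c_def)
qed

section \<open>Coefficients of functions with values in a half-plane\<close>

lemma half_plane_iff:
  fixes u :: complex
  assumes "u \<noteq> 0"
  shows "norm (1 - 1 / u) < 1 \<longleftrightarrow> 1 / 2 < Re u"
proof -
  have "norm (1 - 1 / u) < 1 \<longleftrightarrow> norm (u - 1) < norm u"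
    using assms by (simp add: diff_divide_eq_iff norm_divide divide_less_eq)
  also have "\<dots> \<longleftrightarrow> (norm (u - 1))\<^sup>2 < (norm u)\<^sup>2"
    by (metis norm_ge_zero not_le power2_le_imp_le power_mono)
  also have "\<dots> \<longleftrightarrow> 1 / 2 < Re u"
    unfolding cmod_power2 by (simp add: power2_eq_square algebra_simps)
  finally show ?thesis .
qed

text \<open>Averaging \<open>h = 1/(1 - v)\<close> over the rotations by \<open>n\<close>-th roots of unity stays in the half-plane
\<open>Re > 1/2\<close>, preserves the coefficient of \<open>z^n\<close> and deletes those of \<open>z, \<dots>, z^(n-1)\<close>. Writing
the average as \<open>1/(1 - w)\<close> leads back to a function bounded by 1, whose coefficient of \<open>z^n\<close> is now the
same as that of \<open>h\<close>.\<close>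

lemma half_plane_coeff_le_1:
  fixes v :: "complex \<Rightarrow> complex"
  assumes holo: "v holomorphic_on ball 0 1" and v0: "v 0 = 0"
    and bound: "\<And>z. norm z < 1 \<Longrightarrow> norm (v z) < 1" and n: "0 < n"
  shows "norm (fps_nth (fps_expansion (\<lambda>z. 1 / (1 - v z)) 0) n) \<le> 1"
proof -
  define h where "h z = 1 / (1 - v z)" for z
  define \<omega> where "\<omega> = cis (2 * pi / real n)"
  define k where "k z = (\<Sum>j<n. h (\<omega> ^ j * z)) / of_nat n" for z
  define w where "w z = 1 - 1 / k z" for z
  have v1: "1 - v z \<noteq> 0" if "norm z < 1" for z
    using bound[OF that] by auto
  have h_holo: "h holomorphic_on ball 0 1"
    unfolding h_def by (intro holomorphic_intros holo) (use v1 in auto)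
  have rot: "norm (\<omega> ^ j * z) = norm z" for j z
    by (simp add: \<omega>_def norm_mult norm_power)
  have h_re: "1 / 2 < Re (h z)" if "norm z < 1" for z
    using half_plane_iff[of "h z"] v1[OF that] bound[OF that] by (simp add: h_def)
  have k_re: "1 / 2 < Re (k z)" if "norm z < 1" for z
  proof -
    have "(\<Sum>j<n. 1 / 2 :: real) < (\<Sum>j<n. Re (h (\<omega> ^ j * z)))"
      using n that by (intro sum_strict_mono h_re) (auto simp: rot)
    then show ?thesis
      using n by (simp add: k_def field_simps)
  qed
  have k_nz: "k z \<noteq> 0" if "norm z < 1" for z
    using k_re[OF that] by auto
  have hrot_holo: "(\<lambda>z. h (\<omega> ^ j * z)) holomorphic_on ball 0 1" for j
  proof -
    have "h \<circ> (\<lambda>z. \<omega> ^ j * z) holomorphic_on ball 0 1"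
      by (rule holomorphic_on_compose_gen[OF _ h_holo]) (auto intro!: holomorphic_intros simp: rot)
    then show ?thesis by (simp add: o_def)
  qed
  have k_holo: "k holomorphic_on ball 0 1"
    unfolding k_def by (intro holomorphic_intros hrot_holo) (use n in auto)
  have w_holo: "w holomorphic_on ball 0 1"
    unfolding w_def by (intro holomorphic_intros k_holo) (use k_nz in auto)
  have w_le: "norm (w z) \<le> 1" if "norm z < 1" for z
    using half_plane_iff[OF k_nz[OF that]] k_re[OF that] by (simp add: w_def)
  define H where "H = fps_expansion h 0"
  define K where "K = fps_expansion k 0"
  define W where "W = fps_expansion w 0"
  have exps: "h has_fps_expansion H" "k has_fps_expansion K" "w has_fps_expansion W"
    unfolding H_def K_def W_def
    by (intro unit_disk_has_fps_expansion h_holo k_holo w_holo)+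
  have Knth: "fps_nth K i = (\<Sum>j<n. (\<omega> ^ j) ^ i) * fps_nth H i / of_nat n" for i
  proof -
    have "(\<lambda>z. h (\<omega> ^ j * z)) has_fps_expansion fps_compose H (fps_const (\<omega> ^ j) * fps_X)" for j
    proof -
      have "(h \<circ> (\<lambda>z. \<omega> ^ j * z)) has_fps_expansion fps_compose H (fps_const (\<omega> ^ j) * fps_X)"
        by (intro has_fps_expansion_compose exps fps_expansion_intros) simp
      then show ?thesis by (simp add: o_def)
    qed
    then have "(\<lambda>z. (\<Sum>j<n. h (\<omega> ^ j * z)) * inverse (of_nat n)) has_fps_expansion
        (\<Sum>j<n. fps_compose H (fps_const (\<omega> ^ j) * fps_X)) * fps_const (inverse (of_nat n))"
      by (intro fps_expansion_intros)
    then have "K = (\<Sum>j<n. fps_compose H (fps_const (\<omega> ^ j) * fps_X)) * fps_const (inverse (of_nat n))"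
      using exps(2) by (intro fps_expansion_unique_complex[of k]) (auto simp: k_def[abs_def] divide_inverse)
    then show ?thesis
      by (simp add: fps_sum_nth fps_compose_linear sum_distrib_right divide_inverse)
  qed
  have \<omega>_pow: "\<omega> ^ i = cis (2 * pi * real i / real n)" for i
    unfolding \<omega>_def Complex.DeMoivre by (rule arg_cong[of _ _ cis]) (simp add: ac_simps)
  have \<omega>n: "\<omega> ^ n = 1"
    using n by (simp add: \<omega>_pow)
  have K_mid: "fps_nth K i = 0" if i: "0 < i" "i < n" for i
  proof -
    have "\<omega> ^ i \<noteq> 1"
    proof
      assume "\<omega> ^ i = 1"
      then have "cis (2 * pi * real i / real n) = 1"
        by (simp add: \<omega>_pow)
      then have "cos (2 * pi * real i / real n) = 1"
        by (metis cis.sel(1) one_complex.sel(1))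
      then obtain m :: int where "2 * pi * real i / real n = real_of_int m * 2 * pi"
        by (auto simp: cos_one_2pi_int)
      then have "real i = real_of_int m * real n"
        using n by (simp add: field_simps)
      then have "int i = m * int n"
        by (metis of_int_eq_iff of_int_mult of_int_of_nat_eq)
      then show False
        using i by (metis dvd_triv_right int_dvd_int_iff nat_dvd_not_less)
    qed
    moreover have "(\<Sum>j<n. (\<omega> ^ j) ^ i) = (\<Sum>j<n. (\<omega> ^ i) ^ j)"
      by (intro sum.cong refl) (metis mult.commute power_mult)
    moreover have "(\<omega> ^ i) ^ n = 1"
      using \<omega>n by (metis mult.commute power_mult power_one)
    ultimately have "(\<Sum>j<n. (\<omega> ^ j) ^ i) = 0"
      by (simp add: geometric_sum)
    then show ?thesis by (simp add: Knth)
  qed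
  have K_n: "fps_nth K n = fps_nth H n"
  proof -
    have "(\<omega> ^ j) ^ n = 1" for j
      using \<omega>n by (metis mult.commute power_mult power_one)
    then show ?thesis using n by (simp add: Knth)
  qed
  have K_0: "fps_nth K 0 = 1"
    using n by (simp add: Knth H_def h_def v0)
  have "k 0 = 1"
    using K_0 by (simp add: K_def)
  then have W_0: "fps_nth W 0 = 0"
    by (simp add: W_def w_def)
  \<comment> \<open>In degree \<open>n\<close> of this identity only \<open>W\<^sub>n K\<^sub>0\<close> survives on the left.\<close>
  have "W * K = K - 1"
  proof (rule has_fps_expansion_eq_on_disk)
    show "(\<lambda>z. w z * k z) has_fps_expansion W * K" "(\<lambda>z. k z - 1) has_fps_expansion K - 1"
      by (intro fps_expansion_intros exps)+
    show "w z * k z = k z - 1" if "norm z < 1" for z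
      using k_nz[OF that] by (simp add: w_def field_simps)
  qed
  then have "(\<Sum>i=0..n. fps_nth W i * fps_nth K (n - i)) = fps_nth K n"
    using n by (simp add: fps_mult_nth[symmetric])
  moreover have "(\<Sum>i=0..n. fps_nth W i * fps_nth K (n - i)) = (\<Sum>i\<in>{n}. fps_nth W i * fps_nth K (n - i))"
  proof (rule sum.mono_neutral_right)
    show "\<forall>i\<in>{0..n} - {n}. fps_nth W i * fps_nth K (n - i) = 0"
    proof
      fix i assume i: "i \<in> {0..n} - {n}"
      show "fps_nth W i * fps_nth K (n - i) = 0"
      proof (cases "i = 0")
        case True
        then show ?thesis by (simp add: W_0)
      next
        case False
        then show ?thesis using i K_mid[of "n - i"] by auto
      qed
    qed
  qed auto
  ultimately have "fps_nth W n = fps_nth H n"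
    by (simp add: K_0 K_n)
  moreover have "norm (fps_nth W n) \<le> 1"
    unfolding W_def by (rule schur_coeff_le_1) (use w_holo w_le in \<open>auto simp: schur_function_def\<close>)
  ultimately show ?thesis
    by (simp add: H_def h_def[abs_def])
qed

section \<open>A polynomial inequality\<close>

text \<open>At \<open>x = 1\<close> the quadratic is \<open>2 D - B a + 4 a\<^sup>2\<close>, with discriminant \<open>B\<^sup>2 - 32 D\<close>; this is the
origin of the condition on \<open>B\<close> and \<open>D\<close>. Completing the square at \<open>a = B/8\<close> settles every \<open>x\<close>.\<close>

lemma tangent_quadratic_nonneg:
  fixes x a B D :: real
  assumes "0 \<le> x" "x \<le> 1" "0 \<le> D" "B\<^sup>2 \<le> 32 * D"
  shows "0 \<le> (1 + x) * D - B * x * a + 4 * x * a\<^sup>2"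
proof -
  have "x * B\<^sup>2 \<le> x * (32 * D)"
    using assms by (intro mult_left_mono) auto
  moreover have "0 \<le> 4 * x * (a - B / 8)\<^sup>2"
    using assms by simp
  moreover have "0 \<le> (1 - x) * D"
    using assms by simp
  ultimately show ?thesis
    by (simp add: power2_eq_square algebra_simps)
qed

text \<open>This is the discriminant condition for a quadratic in the proof of \<open>schur_disk_estimate_squared\<close>, with \<open>B\<^sup>2\<close>
replaced by its largest value \<open>32 D\<close>. Both sides agree at \<open>x = 1\<close>; the quotient of their difference
by \<open>1 - x\<close> is the cubic \<open>k + c D + d D\<^sup>2 + 2 x^4 D\<^sup>3\<close> in \<open>D\<close>, in which only \<open>c\<close> can be negative.
Then \<open>c D \<ge> c (1 + D\<^sup>2) / 2\<close>, so it is enough that \<open>2 k + c\<close> and \<open>2 d + c\<close> are nonnegative.\<close>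

lemma discriminant_estimate:
  fixes x D :: real
  assumes "1 / 3 \<le> x" "x \<le> 1" "0 \<le> D"
  shows "4 * D * x * ((1 + D) * x\<^sup>2 - (1 - x) * (3 * x - 1))\<^sup>2
    \<le> ((1 + D) * x\<^sup>2 + 2 * (1 - x)\<^sup>2) *
       (2 * (1 + D) * D * x\<^sup>2 * (1 + x) +
        (1 - x) * (4 * (1 + D) * x\<^sup>2 + 2 * (1 + x)\<^sup>2 * D - 32 * D * x\<^sup>2))"
proof -
  define k where "k = 8 * x^2 - 16 * x^3 + 12 * x^4"
  define c where "c = 4 - 4 * x - 30 * x^2 + 48 * x^3 - 16 * x^4"
  define d where "d = 6 * x^2 - 4 * x^3 - 2 * x^4"
  have x0: "0 \<le> x" using assms by simp
  have k: "0 \<le> k"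
  proof -
    have "k = 4 * x\<^sup>2 * (2 * (1 - x)\<^sup>2 + x\<^sup>2)"
      by (simp add: k_def power2_eq_square power3_eq_cube power4_eq_xxxx algebra_simps)
    then show ?thesis by simp
  qed
  have d: "0 \<le> d"
  proof -
    have "d = 2 * x\<^sup>2 * ((1 - x) * (3 + x))"
      by (simp add: d_def power2_eq_square power3_eq_cube power4_eq_xxxx algebra_simps)
    then show ?thesis using assms by simp
  qed
  have kc: "0 \<le> 2 * k + c"
  proof -
    \<comment> \<open>The square is chosen to match the terms up to \<open>x\<^sup>2\<close>; what remains has the factor \<open>x^3\<close>.\<close>
    have "2 * k + c = (2 - x - 15/4 * x\<^sup>2)\<^sup>2 + x^3 * (17/2 - 97/16 * x)"
      by (simp add: k_def c_def power2_eq_square power3_eq_cube power4_eq_xxxx algebra_simps)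
    then show ?thesis using assms by simp
  qed
  have dc: "0 \<le> 2 * d + c"
  proof (cases "x \<le> 3/5")
    case True
    have "2 * d + c = (2 - x - 19/4 * x\<^sup>2)\<^sup>2 + x^3 * (61/2 - 681/16 * x)"
      by (simp add: d_def c_def power2_eq_square power3_eq_cube power4_eq_xxxx algebra_simps)
    then show ?thesis using True x0 by simp
  next
    case False
    \<comment> \<open>Matching the \<open>x\<^sup>2\<close> term fails near \<open>x = 1\<close>; the coefficient \<open>12/5\<close> works on all of
      \<open>[3/5, 1]\<close>.\<close>
    have "2 * d + c = (2 - x - 12/5 * x\<^sup>2)\<^sup>2 + x\<^sup>2 * (- 47/5 + 176/5 * x - 644/25 * x\<^sup>2)"
      by (simp add: d_def c_def power2_eq_square power3_eq_cube power4_eq_xxxx algebra_simps)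
    moreover have "- 47/5 + 176/5 * x - 644/25 * x\<^sup>2
        = 644/25 * ((x - 3/5) * (1 - x)) + (757/125 - 752/125 * x)"
      by (simp add: power2_eq_square field_simps)
    moreover have "0 \<le> (x - 3/5) * (1 - x)" using False assms by simp
    ultimately show ?thesis using assms by simp
  qed
  have "0 \<le> k + c * D + d * D\<^sup>2"
  proof (cases "0 \<le> c")
    case True
    then show ?thesis using k d assms by simp
  next
    case False
    have "2 * (k + c * D + d * D\<^sup>2) = (2 * k + c) + (2 * d + c) * D\<^sup>2 + (- c) * (1 - D)\<^sup>2"
      by (simp add: power2_eq_square algebra_simps)
    moreover have "0 \<le> (2 * d + c) * D\<^sup>2"
      using dc by simp
    moreover have "0 \<le> (- c) * (1 - D)\<^sup>2"
      by (rule mult_nonneg_nonneg) (use False in auto)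
    ultimately have "0 \<le> 2 * (k + c * D + d * D\<^sup>2)"
      using kc by (metis add_nonneg_nonneg)
    then show ?thesis by simp
  qed
  then have "0 \<le> (1 - x) * (k + c * D + d * D\<^sup>2 + 2 * x^4 * D^3)"
    using assms by simp
  also have "\<dots> = ((1 + D) * x\<^sup>2 + 2 * (1 - x)\<^sup>2) *
       (2 * (1 + D) * D * x\<^sup>2 * (1 + x) +
        (1 - x) * (4 * (1 + D) * x\<^sup>2 + 2 * (1 + x)\<^sup>2 * D - 32 * D * x\<^sup>2))
     - 4 * D * x * ((1 + D) * x\<^sup>2 - (1 - x) * (3 * x - 1))\<^sup>2"
    unfolding k_def c_def d_def by algebra
  finally show ?thesis by simp
qed

text \<open>The difference of the two sides is \<open>(1 - x) E(a)\<close>, where \<open>E\<close> is the sum of two terms with the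
nonnegative factors \<open>2 (1 + D) x\<^sup>2\<close> and \<open>1 - x\<close>. For \<open>x \<le> 1/3\<close> both terms are nonnegative by
\<open>tangent_quadratic_nonneg\<close>, applied to \<open>a\<close> and to \<open>sqrt (a\<^sup>2 + b\<^sup>2)\<close>.

For \<open>x \<ge> 1/3\<close> the odd part of \<open>E\<close> in \<open>a\<close> has a nonpositive coefficient, so \<open>a\<close> may be replaced by
\<open>|a|\<close>. On the line \<open>b = 0\<close> the tangent quadratic \<open>t\<close> divides the second term, which is again nonnegative;
off this line \<open>E\<close> is a convex quadratic in \<open>n = b\<^sup>2\<close> with linear coefficient \<open>(1 - x) c\<close>. If \<open>c < 0\<close>,
the worst case of the linear part is \<open>n = 1\<close>, and adding the first term \<open>2 (1 + D) x\<^sup>2 t\<close> of the line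
\<open>b = 0\<close> gives a quadratic \<open>p a\<^sup>2 - q a + s\<close> of nonpositive discriminant.\<close>

lemma schur_disk_estimate_squared:
  fixes x a b B D :: real
  assumes x: "0 \<le> x" "x \<le> 1" and ab: "a\<^sup>2 + b\<^sup>2 \<le> 1"
    and B: "0 \<le> B" and D: "0 \<le> D" and BD: "B\<^sup>2 \<le> 32 * D"
  shows "((1 + D) * x\<^sup>2 + (1 - x) * (B * x * a + (1 - 3 * x) * (a\<^sup>2 - b\<^sup>2)))\<^sup>2
       + ((1 - x) * (B * x * b + (1 - 3 * x) * (2 * a * b)))\<^sup>2
       \<le> (1 + D - (1 - x\<^sup>2) * (1 - (a\<^sup>2 + b\<^sup>2)))\<^sup>2"
proof -
  define N where "N = a\<^sup>2 + b\<^sup>2"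
  define E where "E a = 2 * (1 + D) * x\<^sup>2 *
        ((1 + x) * D + 2 * (1 - x) * N - B * x * a - 2 * (1 - 3 * x) * a\<^sup>2)
      + (1 - x) * ((1 + x)\<^sup>2 * (D + N)\<^sup>2
          - N * (B\<^sup>2 * x\<^sup>2 + 2 * B * x * (1 - 3 * x) * a + (1 - 3 * x)\<^sup>2 * N))" for a
  have N: "0 \<le> N" "a\<^sup>2 \<le> N" "N \<le> 1"
    using ab by (auto simp: N_def)
  have "(1 + D - (1 - x\<^sup>2) * (1 - (a\<^sup>2 + b\<^sup>2)))\<^sup>2
      - ((1 + D) * x\<^sup>2 + (1 - x) * (B * x * a + (1 - 3 * x) * (a\<^sup>2 - b\<^sup>2)))\<^sup>2
      - ((1 - x) * (B * x * b + (1 - 3 * x) * (2 * a * b)))\<^sup>2 = (1 - x) * E a"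
    unfolding E_def N_def by algebra
  moreover have "0 \<le> E a"
  proof (cases "x \<le> 1 / 3")
    case True
    have "0 \<le> (1 + x) * D - B * x * a + 4 * x * a\<^sup>2"
      by (rule tangent_quadratic_nonneg) (use x D BD in auto)
    moreover have "0 \<le> (1 - x) * (N - a\<^sup>2)"
      using x N by simp
    ultimately have 1: "0 \<le> (1 + x) * D + 2 * (1 - x) * N - B * x * a - 2 * (1 - 3 * x) * a\<^sup>2"
      by (simp add: algebra_simps)
    define \<rho> where "\<rho> = sqrt N"
    have \<rho>: "0 \<le> \<rho>" "\<rho>\<^sup>2 = N"
      using N by (auto simp: \<rho>_def)
    have "a \<le> \<rho>"
      unfolding \<rho>_def using N by (simp add: real_le_rsqrt)
    have "0 \<le> (1 + x) * D - B * x * \<rho> + 4 * x * \<rho>\<^sup>2"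
      by (rule tangent_quadratic_nonneg) (use x D BD in auto)
    then have "\<rho> * (B * x + (1 - 3 * x) * \<rho>) \<le> (1 + x) * (D + N)"
      by (simp add: \<rho>(2)[symmetric] power2_eq_square algebra_simps)
    then have "(\<rho> * (B * x + (1 - 3 * x) * \<rho>))\<^sup>2 \<le> ((1 + x) * (D + N))\<^sup>2"
      using \<rho> B x True by (intro power_mono) auto
    moreover have "(2 * B * x * (1 - 3 * x)) * a \<le> (2 * B * x * (1 - 3 * x)) * \<rho>"
      using \<open>a \<le> \<rho>\<close> B x True by (intro mult_left_mono) auto
    then have "N * (B\<^sup>2 * x\<^sup>2 + 2 * B * x * (1 - 3 * x) * a + (1 - 3 * x)\<^sup>2 * N)
        \<le> N * (B\<^sup>2 * x\<^sup>2 + 2 * B * x * (1 - 3 * x) * \<rho> + (1 - 3 * x)\<^sup>2 * N)"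
      using N by (intro mult_left_mono) auto
    moreover have "N * (B\<^sup>2 * x\<^sup>2 + 2 * B * x * (1 - 3 * x) * \<rho> + (1 - 3 * x)\<^sup>2 * N)
        = (\<rho> * (B * x + (1 - 3 * x) * \<rho>))\<^sup>2"
      unfolding \<rho>(2)[symmetric] by algebra
    ultimately have 2: "0 \<le> (1 + x)\<^sup>2 * (D + N)\<^sup>2
          - N * (B\<^sup>2 * x\<^sup>2 + 2 * B * x * (1 - 3 * x) * a + (1 - 3 * x)\<^sup>2 * N)"
      by (simp add: power_mult_distrib)
    show ?thesis
      unfolding E_def using 1 2 x D by (intro add_nonneg_nonneg mult_nonneg_nonneg) auto
  next
    case False
    define e where "e = 3 * x - 1"
    define \<alpha> where "\<alpha> = \<bar>a\<bar>"
    have e: "0 \<le> e" using False by (simp add: e_def)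
    have \<alpha>: "0 \<le> \<alpha>" "\<alpha>\<^sup>2 = a\<^sup>2" "a \<le> \<alpha>" by (auto simp: \<alpha>_def)
    \<comment> \<open>The sign of the odd part: \<open>(1 - x) (3 x - 1) = x\<^sup>2 - (2 x - 1)\<^sup>2 \<le> x\<^sup>2\<close>.\<close>
    have "E \<alpha> \<le> E a"
    proof -
      have "(1 - x) * e * N \<le> (1 - x) * e * 1"
        using N x e by (intro mult_left_mono) auto
      also have "\<dots> = x\<^sup>2 - (2 * x - 1)\<^sup>2"
        by (simp add: e_def power2_eq_square algebra_simps)
      also have "\<dots> \<le> x\<^sup>2"
        by simp
      also have "\<dots> \<le> (1 + D) * x\<^sup>2"
        using D by (simp add: algebra_simps)
      finally have "0 \<le> 2 * B * x * ((1 + D) * x\<^sup>2 - (1 - x) * e * N) * (\<alpha> - a)"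
        using B x \<alpha> by simp
      also have "\<dots> = E a - E \<alpha>"
        unfolding E_def \<alpha>(2) e_def by (simp add: power2_eq_square algebra_simps)
      finally show ?thesis by simp
    qed
    moreover have "0 \<le> E \<alpha>"
    proof -
      define n where "n = N - \<alpha>\<^sup>2"
      have n: "0 \<le> n" "n \<le> 1"
        using N zero_le_power2[of a] unfolding n_def \<alpha>(2) by linarith+
      define t where "t = (1 + x) * D - B * x * \<alpha> + 4 * x * \<alpha>\<^sup>2"
      define g where "g = ((1 + x) * (D + \<alpha>\<^sup>2) + \<alpha> * (B * x - e * \<alpha>))"
      define c where "c = 4 * (1 + D) * x\<^sup>2 + 2 * (1 + x)\<^sup>2 * D - B\<^sup>2 * x\<^sup>2
        + 2 * B * x * e * \<alpha> + 16 * x * (1 - x) * \<alpha>\<^sup>2"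
      have t: "0 \<le> t"
        unfolding t_def by (rule tangent_quadratic_nonneg) (use x D BD in auto)
      have g: "0 \<le> g"
      proof -
        have "g = (1 + x) * D + \<alpha> * B * x + 2 * (1 - x) * \<alpha>\<^sup>2"
          by (simp add: g_def e_def power2_eq_square algebra_simps)
        then show ?thesis using x D B \<alpha> by simp
      qed
      have split: "E \<alpha> = 2 * (1 + D) * x\<^sup>2 * t + (1 - x) * (c * n)
          + (1 - x) * (t * g + 8 * x * (1 - x) * n\<^sup>2)"
        unfolding E_def t_def g_def c_def n_def e_def by algebra
      have "0 \<le> 2 * (1 + D) * x\<^sup>2 * t + (1 - x) * (c * n)"
      proof (cases "0 \<le> c")
        case True
        then show ?thesis using x D n t by simp
      next
        case cneg: False
        define p where "p = 8 * x * ((1 + D) * x\<^sup>2 + 2 * (1 - x)\<^sup>2)"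
        define q where "q = 2 * B * x * ((1 + D) * x\<^sup>2 - (1 - x) * e)"
        define s where "s r = 2 * (1 + D) * D * x\<^sup>2 * (1 + x) +
          (1 - x) * (4 * (1 + D) * x\<^sup>2 + 2 * (1 + x)\<^sup>2 * D - r * x\<^sup>2)" for r
        have quad: "2 * (1 + D) * x\<^sup>2 * t + (1 - x) * c = p * \<alpha>\<^sup>2 - q * \<alpha> + s (B\<^sup>2)"
          unfolding t_def c_def p_def q_def s_def by algebra
        have p: "0 < p"
        proof -
          have "0 < (1 + D) * x\<^sup>2" using D False by simp
          then have "0 < (1 + D) * x\<^sup>2 + 2 * (1 - x)\<^sup>2"
            by (intro add_pos_nonneg) auto
          then show ?thesis using False by (simp add: p_def)
        qed
        have "q\<^sup>2 = B\<^sup>2 * (4 * x\<^sup>2 * ((1 + D) * x\<^sup>2 - (1 - x) * e)\<^sup>2)"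
          by (simp add: q_def power_mult_distrib)
        \<comment> \<open>\<open>B\<close> occurs in \<open>q\<close> only as a factor, and \<open>s\<close> decreases in \<open>B\<^sup>2\<close>: hence the discriminant is
          largest when \<open>B\<^sup>2 = 32 D\<close>.\<close>
        also have "\<dots> \<le> (32 * D) * (4 * x\<^sup>2 * ((1 + D) * x\<^sup>2 - (1 - x) * e)\<^sup>2)"
          using BD by (intro mult_right_mono) auto
        also have "\<dots> = 32 * x * (4 * D * x * ((1 + D) * x\<^sup>2 - (1 - x) * (3 * x - 1))\<^sup>2)"
          by (simp add: e_def power2_eq_square)
        also have "\<dots> \<le> 32 * x * (((1 + D) * x\<^sup>2 + 2 * (1 - x)\<^sup>2) * s (32 * D))"
          unfolding s_def using discriminant_estimate[of x D] False x D
          by (intro mult_left_mono) (auto simp: algebra_simps)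
        also have "\<dots> = 4 * p * s (32 * D)"
          by (simp add: p_def)
        also have "\<dots> \<le> 4 * p * s (B\<^sup>2)"
        proof -
          have "B\<^sup>2 * x\<^sup>2 \<le> 32 * D * x\<^sup>2"
            using BD by (intro mult_right_mono) auto
          then have "s (32 * D) \<le> s (B\<^sup>2)"
            unfolding s_def using x by (intro add_left_mono mult_left_mono) auto
          then show ?thesis using p by simp
        qed
        finally have "0 \<le> (2 * p * \<alpha> - q)\<^sup>2 + (4 * p * s (B\<^sup>2) - q\<^sup>2)"
          by simp
        also have "\<dots> = 4 * p * (p * \<alpha>\<^sup>2 - q * \<alpha> + s (B\<^sup>2))"
          by (simp add: power2_eq_square algebra_simps)
        finally have "0 \<le> 2 * (1 + D) * x\<^sup>2 * t + (1 - x) * c"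
          unfolding quad using p by (simp add: zero_le_mult_iff)
        moreover have "c * 1 \<le> c * n"
          using cneg n by (intro mult_left_mono_neg) auto
        then have "(1 - x) * c \<le> (1 - x) * (c * n)"
          using x by (intro mult_left_mono) auto
        ultimately show ?thesis by simp
      qed
      moreover have "0 \<le> (1 - x) * (t * g + 8 * x * (1 - x) * n\<^sup>2)"
        using x t g by (intro add_nonneg_nonneg mult_nonneg_nonneg) auto
      ultimately show ?thesis
        unfolding split by (rule add_nonneg_nonneg)
    qed
    ultimately show ?thesis by simp
  qed
  then have "0 \<le> (1 - x) * E a" using x by simp
  ultimately show ?thesis by linarith
qed

section \<open>Bounding the functional\<close>

text \<open>The previous estimate in complex form; \<open>x\<close> will be \<open>|c\<^sub>0|\<^sup>2\<close>, and \<open>y\<close> the first Schur parameter after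
the rotation that makes \<open>c\<^sub>0\<^sup>2\<close> equal to \<open>x\<close>.\<close>

lemma schur_disk_estimate:
  fixes x B D :: real and y :: complex
  assumes x: "0 \<le> x" "x \<le> 1" and y: "norm y \<le> 1"
    and BD: "0 \<le> B" "0 \<le> D" "B\<^sup>2 \<le> 32 * D"
  shows "norm (of_real ((1 + D) * x\<^sup>2) + of_real (1 - x) * (of_real (B * x) * y + of_real (1 - 3 * x) * y\<^sup>2))
    \<le> 1 + D - (1 - x\<^sup>2) * (1 - (norm y)\<^sup>2)"
proof (rule power2_le_imp_le)
  define a b where "a = Re y" and "b = Im y"
  have N: "(norm y)\<^sup>2 = a\<^sup>2 + b\<^sup>2"
    by (simp add: a_def b_def cmod_power2)
  have N1: "a\<^sup>2 + b\<^sup>2 \<le> 1"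
    using y power_mono[of "norm y" 1 2] by (simp add: N)
  let ?Z = "of_real ((1 + D) * x\<^sup>2)
      + of_real (1 - x) * (of_real (B * x) * y + of_real (1 - 3 * x) * y\<^sup>2)"
  have "Re ?Z = (1 + D) * x\<^sup>2 + (1 - x) * (B * x * a + (1 - 3 * x) * (a\<^sup>2 - b\<^sup>2))"
    "Im ?Z = (1 - x) * (B * x * b + (1 - 3 * x) * (2 * a * b))"
    by (simp_all add: a_def b_def power2_eq_square)
  then show "(norm ?Z)\<^sup>2 \<le> (1 + D - (1 - x\<^sup>2) * (1 - (norm y)\<^sup>2))\<^sup>2"
    using schur_disk_estimate_squared[OF x N1 BD] by (simp only: N cmod_power2[of ?Z])
  have "(1 - x\<^sup>2) * (1 - (norm y)\<^sup>2) \<le> 1 * 1"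
    using x N N1 by (intro mult_mono) (auto simp: power_le_one)
  then show "0 \<le> 1 + D - (1 - x\<^sup>2) * (1 - (norm y)\<^sup>2)"
    using BD by simp
qed

text \<open>Rotating the argument makes \<open>c\<^sub>0\<^sup>2\<close> real and nonnegative up to the unimodular factor \<open>\<zeta>\<close>. The last Schur
parameter \<open>s\<close> enters only through \<open>2 c\<^sub>0 c\<^sub>2\<close>; its contribution \<open>R\<close> is estimated by
\<open>2 |c\<^sub>0| \<le> 1 + |c\<^sub>0|\<^sup>2\<close>, which is exactly the gap left by \<open>schur_disk_estimate\<close>.\<close>

lemma schur_functional_le:
  fixes f :: "complex \<Rightarrow> complex" and B D :: real
  assumes f: "schur_function f"
    and BD: "0 \<le> B" "0 \<le> D" "B\<^sup>2 \<le> 32 * D"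
  defines "c \<equiv> fps_nth (fps_expansion f 0)"
  shows "norm (of_real (1 + D) * c 0 ^ 4 + of_real B * (c 0)\<^sup>2 * c 1 + 2 * c 0 * c 2 + (c 1)\<^sup>2) \<le> 1 + D"
proof -
  obtain y s where ys: "norm y \<le> 1" "norm s \<le> 1"
    "c 1 = of_real (1 - (norm (c 0))\<^sup>2) * y"
    "c 2 = of_real (1 - (norm (c 0))\<^sup>2) * (of_real (1 - (norm y)\<^sup>2) * s - cnj (c 0) * y\<^sup>2)"
    unfolding c_def by (rule schur_parameters[OF f])
  define x where "x = (norm (c 0))\<^sup>2"
  define \<zeta> where "\<zeta> = cis (2 * Arg (c 0))"
  define u where "u = y * cnj \<zeta>"
  have c0: "norm (c 0) \<le> 1"
    using schur_coeff_le_1[OF f, of 0] by (simp add: c_def)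
  have x: "0 \<le> x" "x \<le> 1"
    using c0 by (auto simp: x_def power_le_one)
  have \<zeta>: "norm \<zeta> = 1" "\<zeta> * cnj \<zeta> = 1"
    by (auto simp: \<zeta>_def cis_cnj cis_mult)
  have sq: "(c 0)\<^sup>2 = of_real x * \<zeta>"
  proof -
    have "(c 0)\<^sup>2 = (rcis (norm (c 0)) (Arg (c 0)))\<^sup>2"
      by (simp add: rcis_cmod_Arg)
    also have "\<dots> = rcis ((norm (c 0))\<^sup>2) (2 * Arg (c 0))"
      unfolding DeMoivre2 by simp
    finally show ?thesis
      by (simp add: rcis_def x_def \<zeta>_def)
  qed
  have y: "y = \<zeta> * u"
    using \<zeta>(2) by (simp add: u_def mult.left_commute)
  have u: "norm u = norm y"
    by (simp add: u_def norm_mult \<zeta>)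
  have cc: "c 0 * cnj (c 0) = of_real x"
    unfolding x_def by (rule complex_norm_square[symmetric])
  define M where "M = of_real ((1 + D) * x\<^sup>2)
      + of_real (1 - x) * (of_real (B * x) * u + of_real (1 - 3 * x) * u\<^sup>2)"
  define R where "R = 2 * of_real ((1 - x) * (1 - (norm y)\<^sup>2)) * (c 0 * s)"
  have "of_real (1 + D) * c 0 ^ 4 + of_real B * (c 0)\<^sup>2 * c 1 + 2 * c 0 * c 2 + (c 1)\<^sup>2
      = of_real (1 + D) * ((c 0)\<^sup>2)\<^sup>2 + of_real B * (c 0)\<^sup>2 * c 1
        + (2 * of_real (1 - x) * (of_real (1 - (norm y)\<^sup>2) * (c 0 * s) - (c 0 * cnj (c 0)) * y\<^sup>2)) + (c 1)\<^sup>2"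
    unfolding ys(4) x_def[symmetric] by (simp add: algebra_simps flip: power_mult)
  also have "\<dots> = \<zeta>\<^sup>2 * M + R"
    unfolding sq cc ys(3) x_def[symmetric] M_def R_def
    unfolding y by (simp add: power2_eq_square algebra_simps)
  also have "norm \<dots> \<le> norm M + norm R"
    using norm_triangle_ineq[of "\<zeta>\<^sup>2 * M" R] by (simp add: norm_mult norm_power \<zeta>)
  also have "norm M \<le> 1 + D - (1 - x\<^sup>2) * (1 - (norm y)\<^sup>2)"
    unfolding M_def using schur_disk_estimate[of x u B D] x ys(1) BD u by simp
  also have "norm R \<le> (1 - x\<^sup>2) * (1 - (norm y)\<^sup>2)"
  proof -
    have ny: "0 \<le> (1 - x) * (1 - (norm y)\<^sup>2)"
      using x ys(1) by (simp add: power_le_one)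
    have "norm (c 0) * norm s \<le> norm (c 0) * 1"
      using ys(2) by (intro mult_left_mono) auto
    moreover have "2 * norm (c 0) \<le> 1 + x"
      using zero_le_power2[of "1 - norm (c 0)"] by (simp add: x_def power2_eq_square algebra_simps)
    ultimately have "2 * (norm (c 0) * norm s) \<le> 1 + x"
      by simp
    then have "(1 - x) * (1 - (norm y)\<^sup>2) * (2 * (norm (c 0) * norm s))
        \<le> (1 - x) * (1 - (norm y)\<^sup>2) * (1 + x)"
      using ny by (rule mult_left_mono)
    moreover have "norm R = (1 - x) * (1 - (norm y)\<^sup>2) * (2 * (norm (c 0) * norm s))"
      unfolding R_def norm_mult norm_of_real using ny by simp
    ultimately show ?thesis
      by (simp add: power2_eq_square algebra_simps)
  qed
  finally show ?thesis by simp
qed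

section \<open>The coefficient identity and the bound\<close>

text \<open>This extracts the coefficient of \<open>z^4\<close> from \<open>F = (1 + l) H - l + l\<^sup>2 V\<^sup>2 F\<close>. Since \<open>V\<^sup>2\<close> has the factor
\<open>z\<^sup>2\<close>, the last summand involves only the first three coefficients of \<open>F\<close>, and the recursion
\<open>F = 1 + (1 + l) V F - l V\<^sup>2 F\<close> supplies these.\<close>

lemma fps_quotient_coeff_4:
  fixes V Q F H :: "complex fps" and l :: complex
  assumes V: "V = fps_X * Q"
    and F: "(1 - V) * (1 - fps_const l * V) * F = 1" and H: "(1 - V) * H = 1"
  defines "q \<equiv> fps_nth Q"
  shows "fps_nth F 4 = (1 + l) * fps_nth H 4 + l\<^sup>2 *
    ((1 + l + l\<^sup>2) * q 0 ^ 4 + 3 * (1 + l) * (q 0)\<^sup>2 * q 1 + 2 * q 0 * q 2 + (q 1)\<^sup>2)"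
proof -
  define L where "L = fps_const l"
  have c1: "fps_const (1 + l) = 1 + L"
    by (simp add: L_def flip: fps_const_add)
  have rec: "F = 1 + fps_X * ((1 + L) * (Q * F) - fps_X * (L * (Q * (Q * F))))"
    using F unfolding V L_def[symmetric] by (simp add: algebra_simps)
  have F0: "fps_nth F 0 = 1"
    using arg_cong[OF rec, of "\<lambda>F. fps_nth F 0"] by simp
  have F1: "fps_nth F 1 = (1 + l) * q 0"
    using arg_cong[OF rec, of "\<lambda>F. fps_nth F 1"] F0
    by (simp add: q_def flip: c1)
  have F2: "fps_nth F 2 = (1 + l) * q 1 + (1 + l + l\<^sup>2) * (q 0)\<^sup>2"
  proof -
    have "fps_nth F 2 = (1 + l) * (q 0 * fps_nth F 1 + q 1 * fps_nth F 0) - l * (q 0 * (q 0 * fps_nth F 0))"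
      using arg_cong[OF rec, of "\<lambda>F. fps_nth F 2"]
      by (simp add: q_def fps_mult_nth[of Q] numeral_2_eq_2 L_def flip: c1)
    then show ?thesis
      unfolding F0 F1 by (simp add: power2_eq_square algebra_simps)
  qed
  have "F = ((1 - V) * H) * F * (1 - L * V) * (1 + L) - L + L\<^sup>2 * V\<^sup>2 * F"
    (is "_ = ?R")
  proof -
    have "?R - F = ((1 + L) * (1 - L * V) * F) * ((1 - V) * H - 1)
        + L * ((1 - V) * (1 - L * V) * F - 1)"
      by (simp add: power2_eq_square algebra_simps)
    also have "\<dots> = 0"
      using F H by (simp add: L_def)
    finally show ?thesis by simp
  qed
  also have "((1 - V) * H) * F * (1 - L * V) * (1 + L) = (1 + L) * H * ((1 - V) * (1 - L * V) * F)"
    by (simp add: algebra_simps)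
  also have "\<dots> = (1 + L) * H"
    using F by (simp add: L_def)
  also have "L\<^sup>2 * V\<^sup>2 * F = fps_X ^ 2 * (L\<^sup>2 * (Q * (Q * F)))"
    by (simp add: V power2_eq_square algebra_simps)
  finally have split: "F = (1 + L) * H - L + fps_X ^ 2 * (L\<^sup>2 * (Q * (Q * F)))" .
  have "fps_nth ((1 + L) * H) 4 = (1 + l) * fps_nth H 4"
    by (simp flip: c1)
  then have "fps_nth F 4 = (1 + l) * fps_nth H 4 + l\<^sup>2 * fps_nth (Q * (Q * F)) 2"
    using arg_cong[OF split, of "\<lambda>F. fps_nth F 4"]
    by (simp add: fps_X_power_mult_nth L_def power2_eq_square mult.assoc)
  moreover have "fps_nth (Q * (Q * F)) 2
      = q 0 * (q 0 * fps_nth F 2 + q 1 * fps_nth F 1 + q 2 * fps_nth F 0)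
        + q 1 * (q 0 * fps_nth F 1 + q 1 * fps_nth F 0) + q 2 * (q 0 * fps_nth F 0)"
    by (simp add: fps_mult_nth[of Q] q_def numeral_2_eq_2)
  moreover have "\<dots> = (1 + l + l\<^sup>2) * q 0 ^ 4 + 3 * (1 + l) * (q 0)\<^sup>2 * q 1 + 2 * q 0 * q 2 + (q 1)\<^sup>2"
    unfolding F0 F1 F2 by algebra
  ultimately show ?thesis by simp
qed

lemma subordinate_coeff_4_le:
  fixes F :: "complex \<Rightarrow> complex" and lam :: real
  assumes lam: "9 / 23 \<le> lam"  "lam \<le> 1"
    and sub: "F \<prec>\<^sub>s (\<lambda>z. 1 / ((1 + z) * (1 + of_real lam * z)))"
  shows "norm (fps_nth (fps_expansion F 0) 4) \<le> 1 + lam + lam ^ 2 + lam ^ 3 + lam ^ 4"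
proof -
  obtain w where F_holo: "F holomorphic_on unit_disk"
    and w: "w holomorphic_on unit_disk" "w 0 = 0" "\<And>z. norm z < 1 \<Longrightarrow> norm (w z) < 1"
      "\<And>z. norm z < 1 \<Longrightarrow> F z = 1 / ((1 + w z) * (1 + of_real lam * w z))"
    using sub unfolding subordinate_def by auto
  define v where "v z = - w z" for z
  have v: "v holomorphic_on unit_disk" "v 0 = 0" "\<And>z. norm z < 1 \<Longrightarrow> norm (v z) < 1"
    using w by (auto simp: v_def[abs_def] intro!: holomorphic_intros)
  have nz: "1 - v z \<noteq> 0" "1 - of_real lam * v z \<noteq> 0" if z: "norm z < 1" for z
  proof -
    show "1 - v z \<noteq> 0"
      using v(3)[OF z] by auto
    have "norm (of_real lam * v z) \<le> 1 * norm (v z)"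
      unfolding norm_mult using lam by (intro mult_right_mono) auto
    then show "1 - of_real lam * v z \<noteq> 0"
      using v(3)[OF z] by auto
  qed
  define h where "h z = 1 / (1 - v z)" for z
  have h_holo: "h holomorphic_on unit_disk"
    unfolding h_def using nz by (intro holomorphic_intros v) auto
  define V where "V = fps_expansion v 0"
  define H where "H = fps_expansion h 0"
  define P where "P = fps_expansion F 0"
  have exps: "v has_fps_expansion V" "h has_fps_expansion H" "F has_fps_expansion P"
    unfolding V_def H_def P_def
    by (intro unit_disk_has_fps_expansion v h_holo F_holo)+
  have "schur_function v"
    using v by (auto simp: schur_function_def intro: less_imp_le)
  then obtain g where g: "schur_function g"
    "V - fps_const (v 0) = fps_X * fps_expansion g 0 * (1 - fps_const (cnj (v 0)) * V)"
    unfolding V_def using schur_step_fps by blast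
  have Veq: "V = fps_X * fps_expansion g 0"
    using g(2) by (simp add: v(2))
  have "(1 - V) * (1 - fps_const (of_real lam) * V) * P = 1"
  proof (rule has_fps_expansion_eq_on_disk)
    show "(\<lambda>z. (1 - v z) * (1 - of_real lam * v z) * F z) has_fps_expansion
        (1 - V) * (1 - fps_const (of_real lam) * V) * P"
      by (intro fps_expansion_intros exps)
    show "(\<lambda>z. 1) has_fps_expansion (1 :: complex fps)"
      by simp
    show "(1 - v z) * (1 - of_real lam * v z) * F z = 1" if "norm z < 1" for z
      using nz[OF that] w(4)[OF that] by (simp add: v_def)
  qed
  moreover have "(1 - V) * H = 1"
  proof (rule has_fps_expansion_eq_on_disk)
    show "(\<lambda>z. (1 - v z) * h z) has_fps_expansion (1 - V) * H"
      by (intro fps_expansion_intros exps)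
    show "(\<lambda>z. 1) has_fps_expansion (1 :: complex fps)"
      by simp
    show "(1 - v z) * h z = 1" if "norm z < 1" for z
      using nz[OF that] by (simp add: h_def)
  qed
  moreover define q where "q = fps_nth (fps_expansion g 0)"
  moreover define \<Psi> where "\<Psi> = of_real (1 + (lam + lam\<^sup>2)) * q 0 ^ 4
    + of_real (3 * (1 + lam)) * (q 0)\<^sup>2 * q 1 + 2 * q 0 * q 2 + (q 1)\<^sup>2"
  ultimately have "fps_nth P 4 = of_real (1 + lam) * fps_nth H 4 + of_real (lam\<^sup>2) * \<Psi>"
    using fps_quotient_coeff_4[OF Veq, of "of_real lam" P H] by (simp add: add.assoc)
  then have "norm (fps_nth P 4) \<le> norm (of_real (1 + lam) * fps_nth H 4) + norm (of_real (lam\<^sup>2) * \<Psi>)"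
    by (simp only: norm_triangle_ineq)
  also have "norm (of_real (1 + lam) * fps_nth H 4) \<le> (1 + lam) * 1"
  proof -
    have "norm (fps_nth H 4) \<le> 1"
      unfolding H_def h_def using half_plane_coeff_le_1[OF v(1,2), of 4] v(3) by simp
    then show ?thesis
      unfolding norm_mult norm_of_real using lam by (intro mult_mono) auto
  qed
  also have "norm (of_real (lam\<^sup>2) * \<Psi>) \<le> lam\<^sup>2 * (1 + (lam + lam\<^sup>2))"
  proof -
    \<comment> \<open>\<open>9 (1 + \<lambda>) \<le> 32 \<lambda>\<close> is the hypothesis \<open>\<lambda> \<ge> 9/23\<close>.\<close>
    have "(1 + lam) * (9 * (1 + lam)) \<le> (1 + lam) * (32 * lam)"
      using lam by (intro mult_left_mono) auto
    then have "(3 * (1 + lam))\<^sup>2 \<le> 32 * (lam + lam\<^sup>2)"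
      by (simp add: power2_eq_square algebra_simps)
    then have "norm \<Psi> \<le> 1 + (lam + lam\<^sup>2)"
      unfolding \<Psi>_def q_def using lam by (intro schur_functional_le g(1)) auto
    then show ?thesis
      unfolding norm_mult norm_of_real by (simp add: mult_left_mono)
  qed
  finally show ?thesis
    by (simp add: P_def power2_eq_square power3_eq_cube power4_eq_xxxx algebra_simps)
qed

lemma taylor_coeff_Suc_over_id:
  assumes "over_id f holomorphic_on unit_disk" "f 0 = 0"
  shows "taylor_coeff f (Suc n) = fps_nth (fps_expansion (over_id f) 0) n"
proof -
  define F where "F = fps_expansion (over_id f) 0"
  have "over_id f has_fps_expansion F"
    unfolding F_def by (rule unit_disk_has_fps_expansion[OF assms(1)])
  then have "(\<lambda>z. z * over_id f z) has_fps_expansion fps_X * F"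
    by (intro fps_expansion_intros)
  also have "(\<lambda>z. z * over_id f z) = f"
    using assms(2) by (auto simp: over_id_def)
  finally have "fps_expansion f 0 = fps_X * F"
    by (rule fps_expansion_eqI)
  then show ?thesis
    by (simp add: taylor_coeff_def F_def)
qed

section \<open>Sharpness\<close>

text \<open>Here \<open>z/f(z) = 1 + (1 + \<lambda>) z + \<lambda>z\<^sup>2\<close>, so \<open>(z/f(z))\<^sup>2 f'(z) - 1 = - \<lambda>z\<^sup>2\<close>, which has modulus less
than \<open>\<lambda>\<close> on the disk. The coefficients of \<open>f(z)/z\<close> satisfy a two-term recursion.\<close>

lemma extremal_function:
  fixes lam :: real
  assumes lam: "0 < lam" "lam \<le> 1"
  defines "f \<equiv> \<lambda>z :: complex. z / ((1 + z) * (1 + of_real lam * z))"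
  shows "f \<in> class_U lam"
    and "over_id f \<prec>\<^sub>s (\<lambda>z. 1 / ((1 + z) * (1 + of_real lam * z)))"
    and "norm (taylor_coeff f 5) = 1 + lam + lam ^ 2 + lam ^ 3 + lam ^ 4"
proof -
  define G where "G z = 1 / ((1 + z) * (1 + of_real lam * z))" for z :: complex
  have nz: "1 + z \<noteq> 0" "1 + of_real lam * z \<noteq> 0" if z: "norm z < 1" for z :: complex
  proof -
    show "1 + z \<noteq> 0"
      using z by (metis add.inverse_inverse add_eq_0_iff norm_minus_cancel norm_one order_less_irrefl)
    have "norm (of_real lam * z) \<le> 1 * norm z"
      unfolding norm_mult using lam by (intro mult_right_mono) auto
    then show "1 + of_real lam * z \<noteq> 0"
      using z by (metis add.inverse_inverse add_eq_0_iff norm_minus_cancel norm_one mult_1 not_le)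
  qed
  have over: "over_id f = G"
    by (auto simp: over_id_def f_def G_def)
  have G_holo: "G holomorphic_on unit_disk"
    unfolding G_def using nz by (intro holomorphic_intros) auto
  have f_holo: "f holomorphic_on unit_disk"
    unfolding f_def using nz by (intro holomorphic_intros) auto
  have deriv: "deriv f z = (1 - of_real lam * z\<^sup>2) / ((1 + z) * (1 + of_real lam * z))\<^sup>2"
    if z: "norm z < 1" for z
  proof -
    have "((\<lambda>z. (1 + z) * (1 + of_real lam * z)) has_field_derivative
        1 + of_real lam + 2 * of_real lam * z) (at z)"
      by (auto intro!: derivative_eq_intros simp: algebra_simps)
    from DERIV_divide[OF DERIV_ident this] nz[OF z]
    have "deriv f z = (1 * ((1 + z) * (1 + of_real lam * z)) - z * (1 + of_real lam + 2 * of_real lam * z))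
        / ((1 + z) * (1 + of_real lam * z) * ((1 + z) * (1 + of_real lam * z)))"
      unfolding f_def by (intro DERIV_imp_deriv) simp
    also have "1 * ((1 + z) * (1 + of_real lam * z)) - z * (1 + of_real lam + 2 * of_real lam * z)
        = 1 - of_real lam * z\<^sup>2"
      by (simp add: power2_eq_square algebra_simps)
    finally show ?thesis
      by (simp add: power2_eq_square)
  qed
  show "f \<in> class_U lam"
  proof -
    have "deriv f 0 = 1"
      by (simp add: deriv)
    moreover have "norm ((id_over f z)\<^sup>2 * deriv f z - 1) < lam" if z: "norm z < 1" for z
    proof -
      have "id_over f z = (1 + z) * (1 + of_real lam * z)"
        by (auto simp: id_over_def f_def)
      then have "(id_over f z)\<^sup>2 * deriv f z - 1 = - (of_real lam * z\<^sup>2)"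
        using nz[OF z] by (simp add: deriv[OF z])
      moreover have "lam * (norm z)\<^sup>2 < lam * 1"
        using lam z by (intro mult_strict_left_mono) (auto simp: power_less_one_iff abs_square_less_1)
      ultimately show ?thesis
        using lam by (simp add: norm_mult norm_power)
    qed
    ultimately show ?thesis
      using f_holo by (auto simp: class_U_def class_A_def f_def)
  qed
  show "over_id f \<prec>\<^sub>s (\<lambda>z. 1 / ((1 + z) * (1 + of_real lam * z)))"
    unfolding over subordinate_def using G_holo
    by (intro conjI exI[of _ "\<lambda>z. z"]) (auto simp: G_def[abs_def])
  define P where "P = fps_expansion G 0"
  have P: "(1 + fps_X) * (1 + fps_const (of_real lam) * fps_X) * P = 1"
  proof (rule has_fps_expansion_eq_on_disk)
    have "G has_fps_expansion P"
      unfolding P_def by (rule unit_disk_has_fps_expansion[OF G_holo])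
    then show "(\<lambda>z. (1 + z) * (1 + of_real lam * z) * G z) has_fps_expansion
        (1 + fps_X) * (1 + fps_const (of_real lam) * fps_X) * P"
      by (intro fps_expansion_intros)
    show "(\<lambda>z. 1) has_fps_expansion (1 :: complex fps)"
      by simp
    show "(1 + z) * (1 + of_real lam * z) * G z = 1" if "norm z < 1" for z
      using nz[OF that] by (simp add: G_def)
  qed
  define l where "l = complex_of_real lam"
  have rec: "P = 1 - fps_X * (fps_const (1 + l) * P + fps_X * (fps_const l * P))"
    using P by (simp add: l_def algebra_simps flip: fps_const_add)
  have P0: "fps_nth P 0 = 1"
    using arg_cong[OF rec, of "\<lambda>F. fps_nth F 0"] by simp
  have P1: "fps_nth P (Suc 0) = - (1 + l)"
    using arg_cong[OF rec, of "\<lambda>F. fps_nth F (Suc 0)"] P0 by simp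
  have step: "fps_nth P (Suc (Suc n)) = - (1 + l) * fps_nth P (Suc n) - l * fps_nth P n" for n
    using arg_cong[OF rec, of "\<lambda>F. fps_nth F (Suc (Suc n))"] by (simp add: algebra_simps)
  have "f 0 = 0"
    by (simp add: f_def)
  then have "taylor_coeff f 5 = fps_nth P 4"
    using taylor_coeff_Suc_over_id[of f 4, unfolded over] G_holo by (simp add: P_def)
  also have "\<dots> = 1 + l + l ^ 2 + l ^ 3 + l ^ 4"
    by (simp add: numeral_eq_Suc step P0 P1 algebra_simps)
  also have "\<dots> = of_real (1 + lam + lam ^ 2 + lam ^ 3 + lam ^ 4)"
    by (simp add: l_def)
  also have "norm \<dots> = 1 + lam + lam ^ 2 + lam ^ 3 + lam ^ 4"
    unfolding norm_of_real using lam by (simp add: add_nonneg_nonneg)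
  finally show "norm (taylor_coeff f 5) = 1 + lam + lam ^ 2 + lam ^ 3 + lam ^ 4" .
qed

section \<open>The quartic equation\<close>

text \<open>The derivative \<open>36 t\<^sup>3 - 9 t\<^sup>2 + 2 t + 2\<close> is positive for \<open>t > 0\<close>.\<close>

lemma quartic_strict_mono:
  fixes x y :: real
  assumes "0 < x" "x < y"
  shows "9 * x ^ 4 - 3 * x ^ 3 + x ^ 2 + 2 * x - 1 < 9 * y ^ 4 - 3 * y ^ 3 + y ^ 2 + 2 * y - 1"
proof (rule DERIV_pos_imp_increasing[OF assms(2)])
  fix t assume t: "x \<le> t" "t \<le> y"
  have "36 * t ^ 3 - 9 * t ^ 2 + 2 * t + 2 = t * (36 * (t - 1/8)\<^sup>2 + 23/16) + 2"
    by (simp add: power2_eq_square power3_eq_cube field_simps)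
  also have "\<dots> > 0"
    using t assms by (intro add_nonneg_pos mult_nonneg_nonneg) auto
  finally have "0 < 36 * t ^ 3 - 9 * t ^ 2 + 2 * t + 2" .
  moreover have "((\<lambda>x. 9 * x ^ 4 - 3 * x ^ 3 + x ^ 2 + 2 * x - 1) has_real_derivative
      36 * t ^ 3 - 9 * t ^ 2 + 2 * t + 2) (at t)"
    by (auto intro!: derivative_eq_intros)
  ultimately show "\<exists>d. ((\<lambda>x. 9 * x ^ 4 - 3 * x ^ 3 + x ^ 2 + 2 * x - 1) has_real_derivative d) (at t) \<and> 0 < d"
    by blast
qed

lemma quartic_root:
  shows "\<exists>!x. is_pos_root x" and "0.400436 \<le> lambda0" and "lambda0 < 0.400437"
proof -
  define p :: "real \<Rightarrow> real" where "p x = 9 * x ^ 4 - 3 * x ^ 3 + x ^ 2 + 2 * x - 1" for x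
  have lo: "p 0.400436 < 0" and hi: "0 < p 0.400437"
    by (simp_all add: p_def power2_eq_square power3_eq_cube power4_eq_xxxx)
  have "\<exists>x. 0.400436 \<le> x \<and> x \<le> 0.400437 \<and> p x = 0"
    using lo hi by (intro IVT) (auto simp: p_def intro!: continuous_intros)
  then obtain r where r: "0.400436 \<le> r" "r \<le> 0.400437" "p r = 0" by blast
  have r_root: "is_pos_root r"
    using r by (simp add: is_pos_root_def p_def)
  have uniq: "x = r" if "is_pos_root x" for x
  proof (rule ccontr)
    assume "x \<noteq> r"
    then consider "x < r" | "r < x" by linarith
    then show False
      using quartic_strict_mono[of x r] quartic_strict_mono[of r x] that r_root
      by cases (auto simp: is_pos_root_def)
  qed
  show "\<exists>!x. is_pos_root x"
    using r_root uniq by blast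
  have "lambda0 = r"
    unfolding lambda0_def using r_root uniq by (rule the_equality)
  moreover have "r \<noteq> 0.400437"
    using hi r(3) by (metis less_irrefl)
  ultimately show "0.400436 \<le> lambda0" "lambda0 < 0.400437"
    using r by auto
qed

section \<open>The theorem\<close>

theorem theorem1:
  shows "(\<exists>!x. is_pos_root x) \<and> 0.400436 \<le> lambda0 \<and> lambda0 < 0.400437 \<and>
    (\<forall>lam::real. lambda0 \<le> lam \<and> lam \<le> 1 \<longrightarrow>
      (\<forall>f \<in> class_U lam.
         over_id f \<prec>\<^sub>s (\<lambda>z. 1 / ((1 + z) * (1 + of_real lam * z))) \<longrightarrow>
         norm (taylor_coeff f 5) \<le> 1 + lam + lam ^ 2 + lam ^ 3 + lam ^ 4) \<and>
      (\<exists>f \<in> class_U lam.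
         over_id f \<prec>\<^sub>s (\<lambda>z. 1 / ((1 + z) * (1 + of_real lam * z))) \<and>
         norm (taylor_coeff f 5) = 1 + lam + lam ^ 2 + lam ^ 3 + lam ^ 4))"
proof (intro conjI allI impI ballI)
  fix lam :: real
  assume "lambda0 \<le> lam \<and> lam \<le> 1"
  then have lam: "9 / 23 \<le> lam" "0 < lam" "lam \<le> 1"
    using quartic_root(2) by auto
  show "norm (taylor_coeff f 5) \<le> 1 + lam + lam ^ 2 + lam ^ 3 + lam ^ 4"
    if f: "f \<in> class_U lam" and sub: "over_id f \<prec>\<^sub>s (\<lambda>z. 1 / ((1 + z) * (1 + of_real lam * z)))" for f
  proof -
    have "f 0 = 0"
      using f by (simp add: class_U_def class_A_def)
    moreover have "over_id f holomorphic_on unit_disk"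
      using sub by (simp add: subordinate_def)
    ultimately show ?thesis
      using subordinate_coeff_4_le[OF lam(1,3) sub] taylor_coeff_Suc_over_id[of f 4] by simp
  qed
  show "\<exists>f \<in> class_U lam.
         over_id f \<prec>\<^sub>s (\<lambda>z. 1 / ((1 + z) * (1 + of_real lam * z))) \<and>
         norm (taylor_coeff f 5) = 1 + lam + lam ^ 2 + lam ^ 3 + lam ^ 4"
    using extremal_function[OF lam(2,3)] by blast
qed (fact quartic_root)+

end
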